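(* Let $\mathbb{F}$ be any field and let $R$ be a regular subgroup of $\mathrm{AGL}_n(\mathbb{F})$. Then: (a) the center $Z(R)$ of $R$ is unipotent; (b) if $\delta_R$ is linear, then $R$ is unipotent.
   Context: $\mathrm{AGL}_n(\mathbb{F})$ is the subgroup of $\mathrm{GL}_{n+1}(\mathbb{F})$ consisting of the matrices with first column $(1,0,\dots,0)^{\mathrm T}$. A subgroup $R\le\mathrm{AGL}_n(\mathbb{F})$ is regular if for every $v\in\mathbb{F}^n$ there is exactly one element of $R$ with first row $(1,v)$; this element is written $\begin{pmatrix}1&v\\0&I_n+\delta_R(v)\end{pmatrix}$, defining $\delta_R:\mathbb{F}^n\to\mathrm{Mat}_n(\mathbb{F})$; "linear" means $\mathbb{F}$-linear. A subgroup of $\mathrm{AGL}_n(\mathbb{F})$ is unipotent if all its elements $t$ satisfy $(t-I_{n+1})^{n+1}=0$. *)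

theory Defs
  imports "Jordan_Normal_Form.VS_Connect"
begin

definition GL :: "nat \<Rightarrow> 'a::field mat monoid" where
  "GL m = units_of (ring_mat TYPE('a) m ())"

definition AGL :: "nat \<Rightarrow> 'a::field mat monoid" where
  "AGL n = (GL (n + 1))
     \<lparr>carrier := {x \<in> carrier (GL (n + 1)). col x 0 = unit_vec (n + 1) 0}\<rparr>"

definition group_center :: "('a, 'b) monoid_scheme \<Rightarrow> 'a set" where
  "group_center G = {z \<in> carrier G. \<forall>x \<in> carrier G. z \<otimes>\<^bsub>G\<^esub> x = x \<otimes>\<^bsub>G\<^esub> z}"

definition regular_set :: "nat \<Rightarrow> 'a::field mat set \<Rightarrow> bool" where
  "regular_set n R \<longleftrightarrow> (\<forall>v \<in> carrier_vec n. \<exists>!x. x \<in> R \<and> row x 0 = vCons 1 v)"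

definition affine_mat :: "nat \<Rightarrow> 'a::field vec \<Rightarrow> 'a mat \<Rightarrow> 'a mat" where
  "affine_mat n v A = four_block_mat (1\<^sub>m 1) (mat_of_row v) (0\<^sub>m n 1) A"

text \<open>Meaningful when \<open>R\<close> is a regular subgroup of \<open>AGL n\<close> and \<open>v\<close> has
  dimension \<open>n\<close>; see \<open>delta_unique\<close> below.\<close>

definition delta :: "nat \<Rightarrow> 'a::field mat set \<Rightarrow> 'a vec \<Rightarrow> 'a mat" where
  "delta n R v = (THE D. D \<in> carrier_mat n n \<and> affine_mat n v (1\<^sub>m n + D) \<in> R)"

text \<open>Stated for sets of matrices; used for subgroups of \<open>AGL n\<close> only.\<close>

definition unipotent :: "nat \<Rightarrow> 'a::field mat set \<Rightarrow> bool" where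
  "unipotent n U \<longleftrightarrow>
     (\<forall>t \<in> U. (t - 1\<^sub>m (n + 1)) ^\<^sub>m (n + 1) = 0\<^sub>m (n + 1) (n + 1))"

lemma carrier_GL:
  "carrier (GL m) = {x \<in> carrier_mat m m. invertible_mat (x :: 'a::field mat)}"
proof -
  have "x \<in> Units (ring_mat TYPE('a) m ()) \<longleftrightarrow> x \<in> carrier_mat m m \<and> invertible_mat x"
    for x :: "'a mat"
  proof
    assume "x \<in> Units (ring_mat TYPE('a) m ())"
    then show "x \<in> carrier_mat m m \<and> invertible_mat x"
      unfolding Units_def invertible_mat_def inverts_mat_def ring_mat_simps by auto
  next
    assume x: "x \<in> carrier_mat m m \<and> invertible_mat x"
    then obtain B where B: "x * B = 1\<^sub>m m" "B * x = 1\<^sub>m (dim_row B)"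
      unfolding invertible_mat_def inverts_mat_def by auto
    have "dim_col B = m" using arg_cong[OF B(1), of dim_col] by simp
    moreover have "dim_row B = m" using arg_cong[OF B(2), of dim_col] x by auto
    ultimately have "B \<in> carrier_mat m m" "B * x = 1\<^sub>m m" using B(2) by auto
    with x B(1) show "x \<in> Units (ring_mat TYPE('a) m ())"
      unfolding Units_def ring_mat_simps by auto
  qed
  then show ?thesis unfolding GL_def units_of_carrier by auto
qed

lemma group_GL: "group (GL m :: 'a::field mat monoid)"
proof -
  interpret ring "ring_mat TYPE('a) m ()" by (rule ring_mat)
  show ?thesis unfolding GL_def by (rule units_group)
qed

lemma GL_simps: "mult (GL m) = (*)" "one (GL m) = 1\<^sub>m m"
  unfolding GL_def units_of_mult units_of_one ring_mat_simps by auto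

lemma subgroup_AGL: "subgroup (carrier (AGL n)) (GL (n + 1) :: 'a::field mat monoid)"
proof -
  let ?G = "GL (n + 1) :: 'a mat monoid" and ?e = "unit_vec (n + 1) 0 :: 'a vec"
  interpret group ?G by (rule group_GL)
  have C: "x \<in> carrier_mat (n + 1) (n + 1)" if "x \<in> carrier ?G" for x
    using that unfolding carrier_GL by auto
  have col: "col (x * y) 0 = x *\<^sub>v col y 0" if "x \<in> carrier ?G" "y \<in> carrier ?G" for x y
    using C[OF that(1)] C[OF that(2)] by auto
  have e: "x *\<^sub>v ?e = col x 0" if "x \<in> carrier ?G" for x
    using C[OF that] by (intro eq_vecI) (auto simp: scalar_prod_right_unit)
  have A: "carrier (AGL n) = {x \<in> carrier ?G. col x 0 = ?e}"
    unfolding AGL_def by simp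
  show ?thesis
  proof (rule subgroupI)
    show "carrier (AGL n) \<subseteq> carrier ?G" unfolding A by auto
    have "\<one>\<^bsub>?G\<^esub> \<in> carrier (AGL n)" unfolding A using one_closed by (auto simp: GL_simps)
    then show "carrier (AGL n :: 'a mat monoid) \<noteq> {}" by auto
  next
    fix a b :: "'a mat" assume a: "a \<in> carrier (AGL n)" and b: "b \<in> carrier (AGL n)"
    then have *: "a \<in> carrier ?G" "b \<in> carrier ?G" "col a 0 = ?e" "col b 0 = ?e"
      unfolding A by auto
    show "a \<otimes>\<^bsub>?G\<^esub> b \<in> carrier (AGL n)"
      unfolding A using m_closed[OF *(1,2)] col[OF *(1,2)] * e by (simp add: GL_simps)
  next
    fix a :: "'a mat" assume a: "a \<in> carrier (AGL n)"
    then have *: "a \<in> carrier ?G" "col a 0 = ?e" unfolding A by auto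
    let ?b = "inv\<^bsub>?G\<^esub> a"
    have b: "?b \<in> carrier ?G" by (rule inv_closed[OF *(1)])
    have "?b * a = 1\<^sub>m (n + 1)" using l_inv[OF *(1)] by (simp add: GL_simps)
    then have "?b *\<^sub>v col a 0 = ?e" using col[OF b *(1)] by simp
    then show "?b \<in> carrier (AGL n)" unfolding A using b e[OF b] * by simp
  qed
qed

lemma group_AGL: "group (AGL n :: 'a::field mat monoid)"
proof -
  interpret group "GL (n + 1) :: 'a mat monoid" by (rule group_GL)
  have "AGL n = (GL (n + 1) :: 'a mat monoid)\<lparr>carrier := carrier (AGL n)\<rparr>"
    unfolding AGL_def by simp
  then show ?thesis using subgroup_imp_group[OF subgroup_AGL[of n]] by metis
qed

lemma subgroup_group_center: "group G \<Longrightarrow> subgroup (group_center G) G"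
proof -
  assume "group G"
  then interpret group G .
  show ?thesis
  proof (rule subgroupI)
    show "group_center G \<subseteq> carrier G" unfolding group_center_def by auto
    show "group_center G \<noteq> {}" unfolding group_center_def by force
  next
    fix a b assume "a \<in> group_center G" "b \<in> group_center G"
    then have a: "a \<in> carrier G" "\<And>x. x \<in> carrier G \<Longrightarrow> a \<otimes>\<^bsub>G\<^esub> x = x \<otimes>\<^bsub>G\<^esub> a"
      and b: "b \<in> carrier G" "\<And>x. x \<in> carrier G \<Longrightarrow> b \<otimes>\<^bsub>G\<^esub> x = x \<otimes>\<^bsub>G\<^esub> b"
      unfolding group_center_def by auto
    have "a \<otimes>\<^bsub>G\<^esub> b \<otimes>\<^bsub>G\<^esub> x = x \<otimes>\<^bsub>G\<^esub> (a \<otimes>\<^bsub>G\<^esub> b)" if x: "x \<in> carrier G" for x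
    proof -
      have "a \<otimes>\<^bsub>G\<^esub> b \<otimes>\<^bsub>G\<^esub> x = a \<otimes>\<^bsub>G\<^esub> x \<otimes>\<^bsub>G\<^esub> b" using a(1) b x by (simp add: m_assoc)
      also have "\<dots> = x \<otimes>\<^bsub>G\<^esub> (a \<otimes>\<^bsub>G\<^esub> b)"
        unfolding a(2)[OF x] using a(1) b(1) x by (simp add: m_assoc)
      finally show ?thesis .
    qed
    then show "a \<otimes>\<^bsub>G\<^esub> b \<in> group_center G" using a(1) b(1) unfolding group_center_def by auto
  next
    fix a assume "a \<in> group_center G"
    then have a: "a \<in> carrier G" "\<And>x. x \<in> carrier G \<Longrightarrow> a \<otimes>\<^bsub>G\<^esub> x = x \<otimes>\<^bsub>G\<^esub> a"
      unfolding group_center_def by auto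
    have "inv\<^bsub>G\<^esub> a \<otimes>\<^bsub>G\<^esub> x = x \<otimes>\<^bsub>G\<^esub> inv\<^bsub>G\<^esub> a" if x: "x \<in> carrier G" for x
    proof -
      have "inv\<^bsub>G\<^esub> a \<otimes>\<^bsub>G\<^esub> x = inv\<^bsub>G\<^esub> a \<otimes>\<^bsub>G\<^esub> (x \<otimes>\<^bsub>G\<^esub> a \<otimes>\<^bsub>G\<^esub> inv\<^bsub>G\<^esub> a)"
        using a(1) x by (simp add: m_assoc)
      also have "\<dots> = inv\<^bsub>G\<^esub> a \<otimes>\<^bsub>G\<^esub> a \<otimes>\<^bsub>G\<^esub> x \<otimes>\<^bsub>G\<^esub> inv\<^bsub>G\<^esub> a"
        unfolding a(2)[OF x, symmetric] using a(1) x by (simp only: m_assoc inv_closed m_closed)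
      also have "\<dots> = x \<otimes>\<^bsub>G\<^esub> inv\<^bsub>G\<^esub> a" using a(1) x by simp
      finally show ?thesis .
    qed
    then show "inv\<^bsub>G\<^esub> a \<in> group_center G" using a(1) unfolding group_center_def by auto
  qed
qed

lemma delta_unique:
  fixes R :: "'a::field mat set"
  assumes R: "subgroup R (AGL n)" and reg: "regular_set n R" and v: "v \<in> carrier_vec n"
  shows "\<exists>!D. D \<in> carrier_mat n n \<and> affine_mat n v (1\<^sub>m n + D) \<in> R"
proof -
  obtain x where x: "x \<in> R" "row x 0 = vCons 1 v"
    and u: "\<And>y. y \<in> R \<Longrightarrow> row y 0 = vCons 1 v \<Longrightarrow> y = x"
    using reg v unfolding regular_set_def by metis
  have "x \<in> carrier (AGL n)" using x R subgroup.subset by blast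
  then have x': "x \<in> carrier_mat (n + 1) (n + 1)" "col x 0 = unit_vec (n + 1) 0"
    unfolding AGL_def by (auto simp: carrier_GL)
  define D where "D = mat n n (\<lambda>(i,j). x $$ (i+1,j+1)) - 1\<^sub>m n"
  have D: "D \<in> carrier_mat n n" unfolding D_def by (intro minus_carrier_mat) auto
  have r: "x $$ (0, j) = (if j = 0 then 1 else v $ (j - 1))" if "j < n + 1" for j
    using x'(1) that index_row(1)[of 0 x j] vec_index_vCons[of 1 v j] unfolding x(2) by auto
  have c: "x $$ (i, 0) = (if i = 0 then 1 else 0)" if "i < n + 1" for i
  proof -
    have "x $$ (i, 0) = col x 0 $ i" using x'(1) that by auto
    then show ?thesis using x'(2) that by (auto simp: unit_vec_def)
  qed
  have "affine_mat n v (1\<^sub>m n + D) = x"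
    using x'(1) v r c by (intro eq_matI) (auto simp: affine_mat_def D_def)
  moreover have "E = D" if E: "E \<in> carrier_mat n n" and "affine_mat n v (1\<^sub>m n + E) \<in> R" for E
  proof -
    let ?y = "affine_mat n v (1\<^sub>m n + E)"
    have "row ?y 0 = vCons 1 v" using v E
      by (intro eq_vecI) (auto simp: affine_mat_def vec_index_vCons vCons_def split: nat.splits)
    then have y: "?y = x" using u that by auto
    show ?thesis
    proof (rule eq_matI)
      fix i j assume ij: "i < dim_row D" "j < dim_col D"
      have "x $$ (i+1,j+1) = (1\<^sub>m n + E) $$ (i,j)"
        using y[symmetric] ij D E v by (simp add: affine_mat_def)
      then show "E $$ (i,j) = D $$ (i,j)" using ij D E by (simp add: D_def)
    qed (use D E in auto)
  qed
  ultimately show ?thesis using D x(1) by metis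
qed

end

theory Submission
  imports Defs
begin

text \<open>Let row vectors of length m = n + 1 be acted on from the right. For a matrix A and a
  basis vector e_j, the m + 1 vectors e_j A^i with 0 \<le> i \<le> m are dependent. Dividing by the
  lowest nonzero coefficient gives e_j A^k (1 + B) = 0, where k \<le> m and B is a polynomial in A
  without constant term (\<open>row_annihilator\<close>). Both parts turn this into e_j A^k = 0 or
  an equivalent, by exploiting what is known of 1 + B.

  For (b), linearity of delta makes the set of all t - 1 with t in R a non-unital algebra. It
  contains B, so 1 + B lies in R and is invertible. It can be cancelled for every j, and A^m = 0
  (\<open>nilpotent_if_one_add_invertible\<close>).

  For (a), let A = z - 1 with z central. Now 1 + B need not lie in R, but its first row starts with
  1, so by regularity it is the first row of some r in R. Since B commutes with A, e_0 r A^k = 0.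
  Every s in R is r g with g in R, and g commutes with A, so e_0 s A^k = 0 for all s. The rows e_0 s
  are all vectors starting with 1, which span the space (\<open>zero_if_row_zero\<close>), hence A^k
  = 0.\<close>

section \<open>Matrix powers and linear dependence\<close>

lemma pow_mat_add:
  fixes A :: "'a::semiring_1 mat"
  assumes A: "A \<in> carrier_mat n n"
  shows "A ^\<^sub>m (k + l) = A ^\<^sub>m k * A ^\<^sub>m l"
proof (induction l)
  case 0
  then show ?case using A by auto
next
  case (Suc l)
  then show ?case
    using A assoc_mult_mat[of "A ^\<^sub>m k" n n "A ^\<^sub>m l" n A n] by (simp add: pow_carrier_mat)
qed

lemma pow_mat_commute:
  fixes A B :: "'a::semiring_1 mat"
  assumes A: "A \<in> carrier_mat n n" and B: "B \<in> carrier_mat n n" and AB: "A * B = B * A"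
  shows "A ^\<^sub>m k * B = B * A ^\<^sub>m k"
proof (induction k)
  case 0
  then show ?case using A B by simp
next
  case (Suc k)
  have P: "A ^\<^sub>m k \<in> carrier_mat n n" using A by simp
  have "A ^\<^sub>m Suc k * B = A ^\<^sub>m k * (A * B)" using assoc_mult_mat[OF P A B] by simp
  also have "\<dots> = A ^\<^sub>m k * B * A" unfolding AB using assoc_mult_mat[OF P B A] by simp
  also have "\<dots> = B * A ^\<^sub>m Suc k" unfolding Suc using assoc_mult_mat[OF B P A] by simp
  finally show ?case .
qed

lemma row_mult_eq_zero:
  fixes X Y :: "'a::semiring_0 mat"
  assumes "X \<in> carrier_mat a b" "Y \<in> carrier_mat b c" "i < a" "row X i = 0\<^sub>v b"
  shows "row (X * Y) i = 0\<^sub>v c"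
  using assms by (intro eq_vecI) auto

text \<open>The m + 1 vectors are the columns of a square matrix completed by a zero row; its
  determinant vanishes, so it has a nonzero kernel vector. Normalizing the first nonzero
  coefficient, at index k, leaves only indices above k in the sum.\<close>

lemma linear_dependence_relation:
  fixes w :: "nat \<Rightarrow> 'a::field vec"
  assumes w: "\<And>i. i \<le> m \<Longrightarrow> w i \<in> carrier_vec m"
  obtains k f where "k \<le> m"
    and "\<And>r. r < m \<Longrightarrow> w k $ r + (\<Sum>i\<in>{1..m - k}. f i * w (k + i) $ r) = 0"
proof -
  let ?n = "Suc m"
  define M where "M = mat\<^sub>r ?n ?n (\<lambda>r. if r = m then 0\<^sub>v ?n else vec ?n (\<lambda>i. w i $ r))"
  have "det M = 0" unfolding M_def by (rule det_row_0) auto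
  moreover have M: "M \<in> carrier_mat ?n ?n" unfolding M_def by auto
  ultimately obtain c where c: "c \<in> carrier_vec ?n" "c \<noteq> 0\<^sub>v ?n" "M *\<^sub>v c = 0\<^sub>v ?n"
    using det_0_iff_vec_prod_zero_field[OF M] by blast
  have rel: "(\<Sum>i\<in>{..m}. c $ i * w i $ r) = 0" if r: "r < m" for r
  proof -
    have "(M *\<^sub>v c) $ r = 0" using c(3) r by simp
    moreover have "(M *\<^sub>v c) $ r = (\<Sum>i\<in>{0..<?n}. M $$ (r,i) * c $ i)"
      using M c(1) r by (auto simp: scalar_prod_def)
    moreover have "\<dots> = (\<Sum>i\<in>{..m}. c $ i * w i $ r)"
      using r by (intro sum.cong) (auto simp: M_def mult.commute)
    ultimately show ?thesis by simp
  qed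
  have "\<exists>i. i \<le> m \<and> c $ i \<noteq> 0"
  proof (rule ccontr)
    assume "\<not> ?thesis"
    then have "c = 0\<^sub>v ?n" using c(1) by (intro eq_vecI) auto
    with c(2) show False ..
  qed
  define k where "k = (LEAST i. i \<le> m \<and> c $ i \<noteq> 0)"
  have k: "k \<le> m" "c $ k \<noteq> 0"
    using LeastI_ex[OF \<open>\<exists>i. i \<le> m \<and> c $ i \<noteq> 0\<close>] unfolding k_def by blast+
  have k0: "c $ i = 0" if "i < k" for i
    using not_less_Least[OF that[unfolded k_def]] that k(1) by linarith
  have "w k $ r + (\<Sum>i\<in>{1..m - k}. c $ (k + i) / c $ k * w (k + i) $ r) = 0" if r: "r < m" for r
  proof -
    define T where "T = (\<Sum>i\<in>{1..m - k}. c $ (k + i) * w (k + i) $ r)"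
    have "(\<Sum>i\<in>{..m}. c $ i * w i $ r) = (\<Sum>i\<in>{k..m}. c $ i * w i $ r)"
      by (rule sum.mono_neutral_right) (auto simp: k0)
    also have "\<dots> = c $ k * w k $ r + (\<Sum>i\<in>{Suc k..m}. c $ i * w i $ r)"
      by (rule sum.atLeast_Suc_atMost[OF k(1)])
    also have "(\<Sum>i\<in>{Suc k..m}. c $ i * w i $ r) = T"
      unfolding T_def by (rule sum.reindex_bij_witness[of _ "\<lambda>i. k + i" "\<lambda>i. i - k"]) auto
    finally have "c $ k * w k $ r + T = 0" using rel[OF r] by metis
    then have "w k $ r + T / c $ k = 0" using k(2) by (simp add: field_simps)
    moreover have "(\<Sum>i\<in>{1..m - k}. c $ (k + i) / c $ k * w (k + i) $ r) = T / c $ k"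
      unfolding T_def sum_divide_distrib by (rule sum.cong) auto
    ultimately show ?thesis by metis
  qed
  then show thesis by (rule that[OF k(1)])
qed

section \<open>Nilpotency in non-unital matrix algebras\<close>

locale matrix_subalgebra =
  fixes m :: nat and S :: "'a::field mat set"
  assumes S_carrier: "S \<subseteq> carrier_mat m m"
    and zero_closed: "0\<^sub>m m m \<in> S"
    and add_closed: "X \<in> S \<Longrightarrow> Y \<in> S \<Longrightarrow> X + Y \<in> S"
    and smult_closed: "X \<in> S \<Longrightarrow> c \<cdot>\<^sub>m X \<in> S"
    and mult_closed: "X \<in> S \<Longrightarrow> Y \<in> S \<Longrightarrow> X * Y \<in> S"
begin

lemma pow_closed:
  assumes A: "A \<in> S"
  shows "A ^\<^sub>m Suc i \<in> S"
proof (induction i)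
  case 0
  have "A ^\<^sub>m Suc 0 = A" using A S_carrier by auto
  then show ?case using A by simp
next
  case (Suc i)
  have "A ^\<^sub>m Suc (Suc i) = A ^\<^sub>m Suc i * A" by simp
  then show ?case using mult_closed[OF Suc A] by simp
qed

lemma polynomial_closed:
  assumes A: "A \<in> S"
  shows "mat m m (\<lambda>(p,q). \<Sum>i\<in>{1..d}. f i * (A ^\<^sub>m i) $$ (p,q)) \<in> S"
proof (induction d)
  case 0
  have *: "mat m m (\<lambda>(p,q). \<Sum>i\<in>{1..0::nat}. f i * (A ^\<^sub>m i) $$ (p,q)) = 0\<^sub>m m m"
    by (intro eq_matI) auto
  show ?case unfolding * by (rule zero_closed)
next
  case (Suc d)
  have "A \<in> carrier_mat m m" using A S_carrier by auto
  then have *: "mat m m (\<lambda>(p,q). \<Sum>i\<in>{1..Suc d}. f i * (A ^\<^sub>m i) $$ (p,q))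
      = mat m m (\<lambda>(p,q). \<Sum>i\<in>{1..d}. f i * (A ^\<^sub>m i) $$ (p,q)) + f (Suc d) \<cdot>\<^sub>m (A ^\<^sub>m Suc d)"
    by (intro eq_matI) (auto simp del: pow_mat.simps)
  show ?case unfolding * by (rule add_closed[OF Suc smult_closed[OF pow_closed[OF A]]])
qed

text \<open>A substitute for Cayley--Hamilton: the annihilator of the row vector \<open>e\<^sub>j\<close> contains a
  polynomial \<open>x\<^sup>k (1 + x f(x))\<close> with \<open>k \<le> m\<close>.\<close>

lemma row_annihilator:
  assumes A: "A \<in> S" and j: "j < m"
  obtains k B where "k \<le> m" and "B \<in> S" and "row (A ^\<^sub>m k * (1\<^sub>m m + B)) j = 0\<^sub>v m"
proof -
  have AC: "A \<in> carrier_mat m m" using A S_carrier by auto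
  have P: "A ^\<^sub>m i \<in> carrier_mat m m" for i using AC by simp
  obtain k f where k: "k \<le> m"
    and rel: "\<And>r. r < m \<Longrightarrow>
      row (A ^\<^sub>m k) j $ r + (\<Sum>i\<in>{1..m - k}. f i * row (A ^\<^sub>m (k + i)) j $ r) = 0"
    by (rule linear_dependence_relation[of m "\<lambda>i. row (A ^\<^sub>m i) j"])
      (use row_carrier_vec[OF j P] in blast)+
  define B where "B = mat m m (\<lambda>(p,q). \<Sum>i\<in>{1..m - k}. f i * (A ^\<^sub>m i) $$ (p,q))"
  have B: "B \<in> S" unfolding B_def by (rule polynomial_closed[OF A])
  have BC: "B \<in> carrier_mat m m" using B S_carrier by auto
  have "row (A ^\<^sub>m k * (1\<^sub>m m + B)) j = 0\<^sub>v m"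
  proof (rule eq_vecI)
    fix r assume "r < dim_vec (0\<^sub>v m :: 'a vec)"
    then have r: "r < m" by simp
    \<comment> \<open>Expanding B and swapping the sums turns row j of
      \<open>A ^\<^sub>m k * B\<close> into the higher terms of the dependence relation.\<close>
    have "(A ^\<^sub>m k * B) $$ (j,r)
        = (\<Sum>p\<in>{0..<m}. (A ^\<^sub>m k) $$ (j,p) * (\<Sum>i\<in>{1..m - k}. f i * (A ^\<^sub>m i) $$ (p,r)))"
      using P[of k] AC BC j r by (auto simp: scalar_prod_def B_def)
    also have "\<dots> = (\<Sum>i\<in>{1..m - k}. \<Sum>p\<in>{0..<m}. (A ^\<^sub>m k) $$ (j,p) * (f i * (A ^\<^sub>m i) $$ (p,r)))"
      unfolding sum_distrib_left by (rule sum.swap)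
    also have "\<dots> = (\<Sum>i\<in>{1..m - k}. f i * row (A ^\<^sub>m (k + i)) j $ r)"
    proof (rule sum.cong[OF refl])
      fix i
      have "row (A ^\<^sub>m (k + i)) j $ r = (\<Sum>p\<in>{0..<m}. (A ^\<^sub>m k) $$ (j,p) * (A ^\<^sub>m i) $$ (p,r))"
        using P[of k] P[of i] AC j r by (auto simp: scalar_prod_def pow_mat_add[OF AC])
      then show "(\<Sum>p\<in>{0..<m}. (A ^\<^sub>m k) $$ (j,p) * (f i * (A ^\<^sub>m i) $$ (p,r)))
          = f i * row (A ^\<^sub>m (k + i)) j $ r"
        by (simp add: sum_distrib_left ac_simps)
    qed
    finally have "(A ^\<^sub>m k * B) $$ (j,r) = (\<Sum>i\<in>{1..m - k}. f i * row (A ^\<^sub>m (k + i)) j $ r)" .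
    moreover have "A ^\<^sub>m k * (1\<^sub>m m + B) = A ^\<^sub>m k + A ^\<^sub>m k * B"
      using mult_add_distrib_mat[OF P[of k] one_carrier_mat BC] right_mult_one_mat[OF P[of k]] by simp
    ultimately show "row (A ^\<^sub>m k * (1\<^sub>m m + B)) j $ r = 0\<^sub>v m $ r"
      using rel[OF r] P[of k] BC j r AC by simp
  qed (use BC in auto)
  then show thesis using that k B by blast
qed

text \<open>In \<open>row_annihilator\<close> the factor 1 + B can be cancelled, so each row j of
  A^k vanishes for some k depending on j; as k \<le> m always, the common exponent m works for all
  rows.\<close>

lemma nilpotent_if_one_add_invertible:
  assumes A: "A \<in> S" and inv: "\<And>B. B \<in> S \<Longrightarrow> invertible_mat (1\<^sub>m m + B)"
  shows "A ^\<^sub>m m = 0\<^sub>m m m"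
proof (rule eq_rowI)
  fix j assume "j < dim_row (0\<^sub>m m m :: 'a mat)"
  then have j: "j < m" by simp
  have AC: "A \<in> carrier_mat m m" using A S_carrier by auto
  have P: "A ^\<^sub>m i \<in> carrier_mat m m" for i using AC by simp
  obtain k B where k: "k \<le> m" and B: "B \<in> S" and z: "row (A ^\<^sub>m k * (1\<^sub>m m + B)) j = 0\<^sub>v m"
    by (rule row_annihilator[OF A j])
  have I: "1\<^sub>m m + B \<in> carrier_mat m m" using B S_carrier by auto
  \<comment> \<open>Passing through the unit group yields an inverse that is known to be m by
    m.\<close>
  have "1\<^sub>m m + B \<in> carrier (GL m)" unfolding carrier_GL using I inv[OF B] by auto
  then obtain C where C: "C \<in> carrier_mat m m" "(1\<^sub>m m + B) * C = 1\<^sub>m m"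
    unfolding GL_def units_of_carrier Units_def ring_mat_simps by auto
  have "A ^\<^sub>m k * (1\<^sub>m m + B) * C = A ^\<^sub>m k"
    using assoc_mult_mat[OF P[of k] I C(1)] C(2) right_mult_one_mat[OF P[of k]] by simp
  then have "row (A ^\<^sub>m k) j = 0\<^sub>v m"
    using row_mult_eq_zero[OF mult_carrier_mat[OF P[of k] I] C(1) j z] by simp
  then have "row (A ^\<^sub>m k * A ^\<^sub>m (m - k)) j = 0\<^sub>v m"
    by (rule row_mult_eq_zero[OF P P j])
  then show "row (A ^\<^sub>m m) j = row (0\<^sub>m m m) j"
    using pow_mat_add[OF AC, of k "m - k"] k j by simp
qed (use A S_carrier in auto)

end

section \<open>First rows of regular subgroups\<close>

lemma AGL_carrierD:
  assumes "x \<in> carrier (AGL n)"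
  shows "x \<in> carrier_mat (n + 1) (n + 1)" "invertible_mat x" "x $$ (0, 0) = 1"
    "i < n \<Longrightarrow> x $$ (Suc i, 0) = 0"
proof -
  show x: "x \<in> carrier_mat (n + 1) (n + 1)" "invertible_mat x"
    using assms by (auto simp: AGL_def carrier_GL)
  have e: "col x 0 = unit_vec (n + 1) 0" using assms by (auto simp: AGL_def)
  have c: "x $$ (i, 0) = unit_vec (n + 1) 0 $ i" if "i < n + 1" for i
    using index_col[of i x 0] x(1) that unfolding e by auto
  show "x $$ (0, 0) = 1" using c[of 0] by simp
  show "i < n \<Longrightarrow> x $$ (Suc i, 0) = 0" using c[of "Suc i"] by simp
qed

lemma AGL_simps: "mult (AGL n) = (*)" "one (AGL n) = 1\<^sub>m (n + 1)"
  unfolding AGL_def by (simp_all add: GL_simps)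

lemma regular_row_exists:
  assumes "regular_set n R" and "u \<in> carrier_vec (n + 1)" and "u $ 0 = 1"
  shows "\<exists>r \<in> R. row r 0 = u"
proof -
  have "u = vCons 1 (vec n (\<lambda>i. u $ Suc i))"
    using assms(2,3) by (intro eq_vecI) (auto simp: vec_index_vCons)
  then show ?thesis using assms(1) unfolding regular_set_def by (metis vec_carrier)
qed

text \<open>By regularity the first rows of R are all vectors with first entry 1. Each of them kills
  N from the left, and e_0 together with the e_0 + e_p spans the whole space.\<close>

lemma zero_if_row_zero:
  fixes R :: "'a::field mat set"
  assumes reg: "regular_set n R" and R: "R \<subseteq> carrier_mat (n + 1) (n + 1)"
    and N: "N \<in> carrier_mat (n + 1) (n + 1)"
    and z: "\<And>r. r \<in> R \<Longrightarrow> row (r * N) 0 = 0\<^sub>v (n + 1)"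
  shows "N = 0\<^sub>m (n + 1) (n + 1)"
proof -
  have dot: "u \<bullet> col N q = 0" if u: "u \<in> carrier_vec (n + 1)" "u $ 0 = 1" and q: "q < n + 1" for u q
  proof -
    obtain r where r: "r \<in> R" "row r 0 = u" using regular_row_exists[OF reg u] by blast
    have "row (r * N) 0 $ q = 0" using z[OF r(1)] q by simp
    moreover have "row (r * N) 0 $ q = u \<bullet> col N q"
      using r R N q by (subst index_row) auto
    ultimately show ?thesis by simp
  qed
  let ?e = "unit_vec (n + 1) :: nat \<Rightarrow> 'a vec"
  have ep: "?e p \<bullet> col N q = N $$ (p,q)" if "p < n + 1" "q < n + 1" for p q
    using that N by (simp add: scalar_prod_left_unit)
  show ?thesis
  proof (rule eq_matI)
    fix p q assume "p < dim_row (0\<^sub>m (n + 1) (n + 1) :: 'a mat)" "q < dim_col (0\<^sub>m (n + 1) (n + 1) :: 'a mat)"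
    then have pq: "p < n + 1" "q < n + 1" by auto
    have 0: "N $$ (0,q) = 0" using dot[of "?e 0" q] ep[of 0 q] pq by simp
    show "N $$ (p,q) = 0\<^sub>m (n + 1) (n + 1) $$ (p,q)"
    proof (cases "p = 0")
      case False
      have "(?e 0 + ?e p) \<bullet> col N q = 0"
        by (rule dot) (use False pq in auto)
      also have "(?e 0 + ?e p) \<bullet> col N q = ?e 0 \<bullet> col N q + ?e p \<bullet> col N q"
        by (rule add_scalar_prod_distrib[of _ "n + 1"]) (use N pq in auto)
      finally show ?thesis using ep[of 0 q] ep[of p q] pq 0 by simp
    qed (use 0 pq in simp)
  qed (use N in auto)
qed

section \<open>Unipotency of the center\<close>

text \<open>For central \<open>z\<close> the kernel of \<open>(z - 1)\<^sup>k\<close>, acting on row vectors from the right, is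
  \<open>R\<close>-invariant; once it contains one vector with first entry \<open>1\<close> it contains all of them.\<close>

lemma unipotent_center:
  fixes R :: "'a::field mat set"
  assumes sub: "subgroup R (AGL n)" and reg: "regular_set n R"
  shows "unipotent n (group_center ((AGL n)\<lparr>carrier := R\<rparr>))"
  unfolding unipotent_def
proof
  interpret G: group "AGL n :: 'a mat monoid" by (rule group_AGL)
  interpret H: group "(AGL n :: 'a mat monoid)\<lparr>carrier := R\<rparr>"
    by (rule G.subgroup_imp_group[OF sub])
  let ?m = "n + 1"
  fix z assume "z \<in> group_center ((AGL n)\<lparr>carrier := R\<rparr>)"
  then have zR: "z \<in> R" and zc: "\<And>x. x \<in> R \<Longrightarrow> z * x = x * z"
    unfolding group_center_def by (auto simp: AGL_simps)
  have RA: "r \<in> carrier (AGL n)" if "r \<in> R" for r using that sub subgroup.subset by blast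
  note RD = AGL_carrierD[OF RA]
  have RC: "R \<subseteq> carrier_mat ?m ?m" using RD(1) by blast
  have zC: "z \<in> carrier_mat ?m ?m" using RD(1)[OF zR] .
  define A where "A = z - 1\<^sub>m ?m"
  have AC: "A \<in> carrier_mat ?m ?m" unfolding A_def by (intro minus_carrier_mat) auto
  have Ac: "A * x = x * A" if "x \<in> R" for x
    unfolding A_def using zc[OF that] RD(1)[OF that] zC
    by (simp add: minus_mult_distrib_mat[of _ ?m ?m] mult_minus_distrib_mat[of _ ?m ?m])
  have P: "A ^\<^sub>m i \<in> carrier_mat ?m ?m" for i using AC by simp
  \<comment> \<open>Commuting with A lets 1 + B move past A^k. The zero first column gives 1 + B the
    top left entry 1 that regularity needs; the whole column is demanded because that condition
    survives products.\<close>
  define S where "S = {B \<in> carrier_mat ?m ?m. A * B = B * A \<and> (\<forall>i<?m. B $$ (i,0) = 0)}"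
  interpret matrix_subalgebra ?m S
  proof
    show "S \<subseteq> carrier_mat ?m ?m" unfolding S_def by auto
    show "0\<^sub>m ?m ?m \<in> S" unfolding S_def using AC by auto
    fix X Y c assume X: "X \<in> S"
    then show "c \<cdot>\<^sub>m X \<in> S" unfolding S_def using AC
      by (auto simp: mult_smult_distrib[of A ?m ?m] mult_smult_assoc_mat[of _ ?m ?m _ ?m])
    assume Y: "Y \<in> S"
    have XY: "X \<in> carrier_mat ?m ?m" "Y \<in> carrier_mat ?m ?m" "A * X = X * A" "A * Y = Y * A"
      using X Y unfolding S_def by auto
    show "X + Y \<in> S" using X Y AC unfolding S_def
      by (auto simp: mult_add_distrib_mat[of _ ?m ?m] add_mult_distrib_mat[of _ ?m ?m])
    have "A * (X * Y) = X * Y * A"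
      using assoc_mult_mat[OF AC XY(1,2)] assoc_mult_mat[OF XY(1) AC XY(2)]
        assoc_mult_mat[OF XY(1,2) AC] XY(3,4) by simp
    moreover have "(X * Y) $$ (i,0) = 0" if "i < ?m" for i
    proof -
      have "col Y 0 = 0\<^sub>v ?m" using Y unfolding S_def by (intro eq_vecI) auto
      then show ?thesis using XY(1,2) that by auto
    qed
    ultimately show "X * Y \<in> S" using XY unfolding S_def by auto
  qed
  have "A $$ (i,0) = 0" if "i < ?m" for i
    using that RD(3,4)[OF zR] zC by (cases i) (auto simp: A_def)
  then have "A \<in> S" unfolding S_def using AC by auto
  then obtain k B where k: "k \<le> ?m" and B: "B \<in> S"
    and kB: "row (A ^\<^sub>m k * (1\<^sub>m ?m + B)) 0 = 0\<^sub>v ?m"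
    using row_annihilator[of A 0] by auto
  have BC: "B \<in> carrier_mat ?m ?m" and AB: "A * B = B * A" and B0: "B $$ (0,0) = 0"
    using B unfolding S_def by auto
  let ?I = "1\<^sub>m ?m + B"
  have I: "?I \<in> carrier_mat ?m ?m" using BC by auto
  have "A * ?I = ?I * A"
    using mult_add_distrib_mat[OF AC one_carrier_mat BC] add_mult_distrib_mat[OF one_carrier_mat BC AC]
      AB AC by simp
  then have comm: "A ^\<^sub>m k * ?I = ?I * A ^\<^sub>m k" by (rule pow_mat_commute[OF AC I])
  have "row ?I 0 \<in> carrier_vec ?m" using I by (intro row_carrier_vec) auto
  moreover have "row ?I 0 $ 0 = 1" using BC B0 by auto
  \<comment> \<open>Only row 0 of 1 + B matters, so r can stand in for 1 + B although the two
    matrices may differ elsewhere.\<close>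
  ultimately obtain r where r: "r \<in> R" "row r 0 = row ?I 0"
    using regular_row_exists[OF reg] by blast
  have "row (r * A ^\<^sub>m k) 0 = row (?I * A ^\<^sub>m k) 0"
    using r(2) RD(1)[OF r(1)] I P[of k] by (intro eq_vecI) auto
  then have r0: "row (r * A ^\<^sub>m k) 0 = 0\<^sub>v ?m" using kB comm by simp
  have "A ^\<^sub>m k = 0\<^sub>m ?m ?m"
  proof (rule zero_if_row_zero[OF reg RC P])
    fix s assume s: "s \<in> R"
    \<comment> \<open>Writing s = r g transports the vanishing from r to s, since g commutes with
      A^k.\<close>
    define g where "g = inv\<^bsub>AGL n\<^esub> r \<otimes>\<^bsub>AGL n\<^esub> s"
    have g: "g \<in> R" unfolding g_def
      by (intro subgroup.m_closed[OF sub] subgroup.m_inv_closed[OF sub] r(1) s)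
    have "r \<otimes>\<^bsub>AGL n\<^esub> g = s" unfolding g_def
      using RA[OF r(1)] RA[OF s] by (simp add: G.m_assoc[symmetric])
    then have "s * A ^\<^sub>m k = r * (g * A ^\<^sub>m k)"
      using assoc_mult_mat[OF RD(1)[OF r(1)] RD(1)[OF g] P[of k]] by (simp add: AGL_simps)
    also have "\<dots> = r * A ^\<^sub>m k * g"
      using pow_mat_commute[OF AC RD(1)[OF g] Ac[OF g], of k]
        assoc_mult_mat[OF RD(1)[OF r(1)] P[of k] RD(1)[OF g]] by simp
    finally show "row (s * A ^\<^sub>m k) 0 = 0\<^sub>v ?m"
      using row_mult_eq_zero[OF mult_carrier_mat[OF RD(1)[OF r(1)] P[of k]] RD(1)[OF g] _ r0] by simp
  qed
  then have "A ^\<^sub>m ?m = 0\<^sub>m ?m ?m"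
    using pow_mat_add[OF AC, of k "?m - k"] k left_mult_zero_mat[OF P[of "?m - k"]]
    by (simp del: pow_mat.simps)
  then show "(z - 1\<^sub>m ?m) ^\<^sub>m ?m = 0\<^sub>m ?m ?m" unfolding A_def .
qed

section \<open>Linear delta\<close>

text \<open>An element x of R and the affine matrix that delta builds from the first row of x both
  lie in R and share that row, so uniqueness in \<open>regular_set\<close> identifies them.\<close>

lemma regular_eq_affine_mat_delta:
  fixes R :: "'a::field mat set"
  assumes sub: "subgroup R (AGL n)" and reg: "regular_set n R"
  shows "R = (\<lambda>v. affine_mat n v (1\<^sub>m n + delta n R v)) ` carrier_vec n"
    and "v \<in> carrier_vec n \<Longrightarrow> delta n R v \<in> carrier_mat n n"
proof -
  have d: "delta n R v \<in> carrier_mat n n" "affine_mat n v (1\<^sub>m n + delta n R v) \<in> R"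
    if "v \<in> carrier_vec n" for v
    using theI'[OF delta_unique[OF sub reg that]] unfolding delta_def by auto
  show "v \<in> carrier_vec n \<Longrightarrow> delta n R v \<in> carrier_mat n n" by (rule d)
  have "x \<in> (\<lambda>v. affine_mat n v (1\<^sub>m n + delta n R v)) ` carrier_vec n" if x: "x \<in> R" for x
  proof -
    have "x \<in> carrier (AGL n)" using x sub subgroup.subset by blast
    note xD = AGL_carrierD[OF this]
    let ?v = "vec n (\<lambda>i. x $$ (0, Suc i))"
    have v: "?v \<in> carrier_vec n" by simp
    let ?y = "affine_mat n ?v (1\<^sub>m n + delta n R ?v)"
    have "row x 0 = vCons 1 ?v" using xD(1,3)
      by (intro eq_vecI) (auto simp: vec_index_vCons)
    moreover have "row ?y 0 = vCons 1 ?v" using d(1)[OF v]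
      by (intro eq_vecI) (auto simp: affine_mat_def vec_index_vCons)
    ultimately have "x = ?y" using reg v x d(2)[OF v] unfolding regular_set_def by blast
    then show ?thesis using v by blast
  qed
  then show "R = (\<lambda>v. affine_mat n v (1\<^sub>m n + delta n R v)) ` carrier_vec n"
    using d(2) by blast
qed

text \<open>Linearity of \<open>\<delta>\<close> makes \<open>{t - 1 | t \<in> R}\<close> a linear space, and
  \<open>(1 + a)(1 + b) = 1 + (a + b + ab)\<close> then makes it closed under products. So every
  \<open>1 + a f(a)\<close> lies in \<open>R\<close> and is invertible.\<close>

lemma unipotent_if_delta_linear:
  fixes R :: "'a::field mat set"
  assumes sub: "subgroup R (AGL n)" and reg: "regular_set n R"
    and lin: "linear_map class_ring (module_vec TYPE('a) n) (module_mat TYPE('a) n n) (delta n R)"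
  shows "unipotent n R"
proof -
  let ?m = "n + 1"
  let ?d = "delta n R"
  note dC = regular_eq_affine_mat_delta(2)[OF sub reg]
  have hom: "?d \<in> LinearCombinations.module_hom class_ring (module_vec TYPE('a) n) (module_mat TYPE('a) n n)"
    using lin unfolding linear_map_def mod_hom_def mod_hom_axioms_def by blast
  have d_add: "?d (v + w) = ?d v + ?d w" if "v \<in> carrier_vec n" "w \<in> carrier_vec n" for v w
    using hom that unfolding LinearCombinations.module_hom_def by (auto simp: module_vec_simps module_mat_simps)
  have d_smult: "?d (c \<cdot>\<^sub>v v) = c \<cdot>\<^sub>m ?d v" if "v \<in> carrier_vec n" for c v
    using hom that unfolding LinearCombinations.module_hom_def
    by (auto simp: module_vec_simps module_mat_simps class_ring_simps)
  have RA: "r \<in> carrier (AGL n)" if "r \<in> R" for r using that sub subgroup.subset by blast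
  note RD = AGL_carrierD[OF RA]
  define e where "e v = affine_mat n v (1\<^sub>m n + ?d v) - 1\<^sub>m ?m" for v
  define S where "S = e ` carrier_vec n"
  have one_e: "1\<^sub>m ?m + e v = affine_mat n v (1\<^sub>m n + ?d v)" if "v \<in> carrier_vec n" for v
    using that dC[OF that] unfolding e_def by (intro eq_matI) (auto simp: affine_mat_def)
  have SR: "1\<^sub>m ?m + X \<in> R" if "X \<in> S" for X
  proof -
    obtain v where "v \<in> carrier_vec n" "X = e v" using \<open>X \<in> S\<close> unfolding S_def by blast
    then show ?thesis using one_e regular_eq_affine_mat_delta(1)[OF sub reg] by blast
  qed
  have RS: "t - 1\<^sub>m ?m \<in> S" if "t \<in> R" for t
  proof -
    obtain v where "v \<in> carrier_vec n" "t = affine_mat n v (1\<^sub>m n + ?d v)"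
      using \<open>t \<in> R\<close> regular_eq_affine_mat_delta(1)[OF sub reg] by blast
    then show ?thesis unfolding S_def e_def by blast
  qed
  have SC: "S \<subseteq> carrier_mat ?m ?m" unfolding S_def e_def by (auto intro!: minus_carrier_mat)
  \<comment> \<open>Subtracting the identity leaves zero first column and the blocks v and delta v,
    so \<open>e\<close> is linear in v as soon as delta is.\<close>
  have ind: "e v = mat ?m ?m (\<lambda>(i,j). if j = 0 then 0 else if i = 0 then v $ (j - 1)
      else ?d v $$ (i - 1, j - 1))"
    if "v \<in> carrier_vec n" for v
    using that dC[OF that] unfolding e_def
    by (intro eq_matI) (auto simp: affine_mat_def)
  have e_add: "e v + e w = e (v + w)" if "v \<in> carrier_vec n" "w \<in> carrier_vec n" for v w
    using that dC[OF that(1)] dC[OF that(2)] d_add[OF that] ind[of v] ind[of w] ind[of "v + w"]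
    by (intro eq_matI) auto
  have e_smult: "c \<cdot>\<^sub>m e v = e (c \<cdot>\<^sub>v v)" if "v \<in> carrier_vec n" for c v
    using that dC[OF that] d_smult[OF that] ind[of v] ind[of "c \<cdot>\<^sub>v v"]
    by (intro eq_matI) auto
  have add: "X + Y \<in> S" if "X \<in> S" "Y \<in> S" for X Y
    using that e_add unfolding S_def by auto
  have smult: "c \<cdot>\<^sub>m X \<in> S" if "X \<in> S" for X c
    using that e_smult unfolding S_def by auto
  interpret matrix_subalgebra ?m S
  proof
    show "S \<subseteq> carrier_mat ?m ?m" by (rule SC)
    have "1\<^sub>m ?m \<in> R" using subgroup.one_closed[OF sub] by (simp add: AGL_simps)
    moreover have "1\<^sub>m ?m - 1\<^sub>m ?m = (0\<^sub>m ?m ?m :: 'a mat)" by (intro eq_matI) auto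
    ultimately show "0\<^sub>m ?m ?m \<in> S" using RS by metis
    fix X Y c assume X: "X \<in> S"
    then show "c \<cdot>\<^sub>m X \<in> S" by (rule smult)
    assume Y: "Y \<in> S"
    show "X + Y \<in> S" by (rule add[OF X Y])
    have XY: "X \<in> carrier_mat ?m ?m" "Y \<in> carrier_mat ?m ?m" using X Y SC by auto
    have "(1\<^sub>m ?m + X) * (1\<^sub>m ?m + Y) \<in> R"
      using subgroup.m_closed[OF sub SR[OF X] SR[OF Y]] by (simp add: AGL_simps)
    \<comment> \<open>The product is recovered as XY = ((1 + X)(1 + Y) - 1) - (X + Y): the first
      term is in \<open>S\<close> because R is closed under products, the second because
      \<open>S\<close> is a linear space.\<close>
    then have "(1\<^sub>m ?m + X) * (1\<^sub>m ?m + Y) - 1\<^sub>m ?m + (- 1) \<cdot>\<^sub>m (X + Y) \<in> S"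
      by (intro add RS smult X Y)
    also have "(1\<^sub>m ?m + X) * (1\<^sub>m ?m + Y) = (1\<^sub>m ?m + X) + (Y + X * Y)"
      using XY add_mult_distrib_mat[of "1\<^sub>m ?m" ?m ?m X "1\<^sub>m ?m + Y" ?m]
        mult_add_distrib_mat[of X ?m ?m "1\<^sub>m ?m" ?m Y]
      by (simp, intro eq_matI) auto
    also have "\<dots> - 1\<^sub>m ?m + (- 1) \<cdot>\<^sub>m (X + Y) = X * Y"
      using XY by (intro eq_matI) auto
    finally show "X * Y \<in> S" .
  qed
  show ?thesis unfolding unipotent_def
    using nilpotent_if_one_add_invertible[OF RS] RD(2)[OF SR] by blast
qed

theorem theorem2p4:
  fixes n :: nat and R :: "'a::field mat set"
  assumes "subgroup R (AGL n)"
    and "regular_set n R"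
  shows "unipotent n (group_center ((AGL n)\<lparr>carrier := R\<rparr>))
    \<and> (linear_map class_ring (module_vec TYPE('a) n) (module_mat TYPE('a) n n) (delta n R)
        \<longrightarrow> unipotent n R)"
  using unipotent_center[OF assms] unipotent_if_delta_linear[OF assms] by blast

end
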